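(* For every finite partition of $\mathbb{N}$, there exist two injective sequences $\langle x_j\rangle_j$ and $\langle y_j\rangle_j$ in $\mathbb{N}$ such that $FEX(\langle x_j\rangle_j)\cup FP(\langle y_j\rangle_j)$ is contained in a single cell of the partition.
   Context: $FEX(\langle x_j\rangle_j)=\{x_{i_k}^{x_{i_{k-1}}^{\cdot^{\cdot^{\cdot^{x_{i_1}}}}}}:k\in\mathbb{N},\ 1\le i_1<\cdots<i_k\}$ (the Hindman tower, towers evaluated from the top down), and $FP(\langle y_j\rangle_j)=\{\prod_{t\in H}y_t:H\text{ a nonempty finite subset of }\mathbb{N}\}$. *)

theory Defs
  imports Main "HOL-Library.Disjoint_Sets"
begin

text \<open>
  The exponential tower of a list, base first, evaluated from the top down:
  \<open>tower [a, b, c] = a ^ (b ^ c)\<close>.  The empty tower is \<open>1\<close>, so that \<open>tower [a] = a\<close>.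
\<close>

fun tower :: "nat list \<Rightarrow> nat" where
  "tower [] = 1"
| "tower (a # as) = a ^ tower as"

text \<open>
  The list \<open>is\<close> is \<open>i\<^sub>1 < \<dots> < i\<^sub>k\<close> with \<open>k \<ge> 1\<close>; it is reversed because the
  largest index \<open>i\<^sub>k\<close> is at the base of the tower and \<open>i\<^sub>1\<close> is at the top.
\<close>

definition FEX :: "(nat \<Rightarrow> nat) \<Rightarrow> nat set" where
  "FEX x = {tower (map x (rev is)) | is. is \<noteq> [] \<and> sorted_wrt (<) is}"

definition FP :: "(nat \<Rightarrow> nat) \<Rightarrow> nat set" where
  "FP y = {\<Prod>t\<in>H. y t | H. finite H \<and> H \<noteq> {}}"

end

theory Submission
  imports Defs "HOL-Library.Nat_Bijection"
begin

text \<open>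
  Taking \<open>x = 2 ^ a\<close> and \<open>y = 2 ^ b\<close> turns products into sums and the tower step
  \<open>x\<^sub>n ^ t\<close>, for \<open>t = 2 ^ e\<close>, into \<open>a\<^sub>n * 2 ^ e\<close>.  So one wants a colour class \<open>A\<close> of
  exponents that contains all finite sums of some \<open>b\<close> and is closed under this step along \<open>a\<close>.
  Call a set large if it is multiplicatively piecewise syndetic, where the thick set involved
  contains not just single points but dilates of sets of an additive idempotent ultrafilter.
  Largeness is partition regular, so some colour class \<open>A\<close> is large, and every large set contains
  all finite sums of an infinite sequence.  By the IP van der Waerden theorem, a large \<open>B\<close>
  contains some \<open>d\<close> such that \<open>{y. \<forall>j\<le>k. 2 ^ (d * j) * y \<in> B}\<close> is large again; iterating this,
  with \<open>k\<close> exceeding all towers built so far, yields \<open>a\<close>.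
\<close>

section \<open>Idempotent ultrafilters\<close>

definition shift :: "nat \<Rightarrow> nat set \<Rightarrow> nat set" where
  "shift x A = {y. x + y \<in> A}"

definition set_filter :: "'a set set \<Rightarrow> bool" where
  "set_filter F \<longleftrightarrow> UNIV \<in> F \<and> {} \<notin> F \<and> (\<forall>A\<in>F. \<forall>B\<in>F. A \<inter> B \<in> F) \<and> (\<forall>A\<in>F. \<forall>B. A \<subseteq> B \<longrightarrow> B \<in> F)"

text \<open>For an ultrafilter this says that it is contained in, hence equal to, its sum with
  itself. For a filter it makes the closed set of ultrafilters extending \<open>F\<close> a
  subsemigroup; larger filters stand for smaller subsemigroups.\<close>

definition subidempotent :: "nat set set \<Rightarrow> bool" where
  "subidempotent F \<longleftrightarrow> (\<forall>A\<in>F. {x. shift x A \<in> F} \<in> F)"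

lemma shift_simps [simp]:
  "shift x UNIV = UNIV" "shift x {} = {}" "shift x (A \<inter> B) = shift x A \<inter> shift x B"
  by (auto simp: shift_def)

lemma shift_shift: "shift y (shift x A) = shift (x + y) A"
  by (auto simp: shift_def add.assoc)

lemma shift_mono: "A \<subseteq> B \<Longrightarrow> shift x A \<subseteq> shift x B"
  by (auto simp: shift_def)

lemma set_filterI:
  assumes "UNIV \<in> F" "{} \<notin> F" "\<And>A B. A \<in> F \<Longrightarrow> B \<in> F \<Longrightarrow> A \<inter> B \<in> F"
    "\<And>A B. A \<in> F \<Longrightarrow> A \<subseteq> B \<Longrightarrow> B \<in> F"
  shows "set_filter F"
  using assms unfolding set_filter_def by blast

lemma set_filterD:
  assumes "set_filter F"
  shows "UNIV \<in> F" "{} \<notin> F" "A \<in> F \<Longrightarrow> B \<in> F \<Longrightarrow> A \<inter> B \<in> F" "A \<in> F \<Longrightarrow> A \<subseteq> B \<Longrightarrow> B \<in> F"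
  using assms unfolding set_filter_def by blast+

lemma set_filter_Union_chain:
  assumes "\<C> \<noteq> {}" "subset.chain {F. set_filter F} \<C>"
  shows "set_filter (\<Union>\<C>)"
proof (rule set_filterI)
  have F: "set_filter F" if "F \<in> \<C>" for F
    using assms that by (auto simp: subset.chain_def)
  show "UNIV \<in> \<Union>\<C>" "{} \<notin> \<Union>\<C>"
    using assms(1) F set_filterD(1,2) by blast+
  show "B \<in> \<Union>\<C>" if "A \<in> \<Union>\<C>" "A \<subseteq> B" for A B
    using that F set_filterD(4) by blast
  show "A \<inter> B \<in> \<Union>\<C>" if AB: "A \<in> \<Union>\<C>" "B \<in> \<Union>\<C>" for A B
  proof -
    obtain F G where "F \<in> \<C>" "G \<in> \<C>" "A \<in> F" "B \<in> G"
      using AB by blast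
    moreover have "F \<subseteq> G \<or> G \<subseteq> F"
      using assms(2) \<open>F \<in> \<C>\<close> \<open>G \<in> \<C>\<close> by (auto simp: subset.chain_def)
    ultimately show ?thesis
      using F set_filterD(3) by blast
  qed
qed

lemma ex_ultrafilter:
  assumes "set_filter F"
  obtains U where "set_filter U" "F \<subseteq> U" "\<And>A. A \<in> U \<or> - A \<in> U"
proof -
  let ?S = "{U. set_filter U \<and> F \<subseteq> U}"
  have "\<exists>U\<in>?S. \<forall>X\<in>?S. U \<subseteq> X \<longrightarrow> X = U"
  proof (rule subset_Zorn_nonempty)
    show "?S \<noteq> {}" using assms by blast
    fix \<C> assume \<C>: "\<C> \<noteq> {}" "subset.chain ?S \<C>"
    then have "subset.chain {F. set_filter F} \<C>"
      by (auto simp: subset.chain_def)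
    then have "set_filter (\<Union>\<C>)"
      using set_filter_Union_chain \<C>(1) by blast
    moreover have "F \<subseteq> \<Union>\<C>"
      using \<C> unfolding subset.chain_def by blast
    ultimately show "\<Union>\<C> \<in> ?S" by blast
  qed
  then obtain U where U: "set_filter U" "F \<subseteq> U"
    and max: "\<And>X. set_filter X \<Longrightarrow> U \<subseteq> X \<Longrightarrow> X = U"
    by (auto intro: subset_trans)
  have "A \<in> U \<or> - A \<in> U" for A
  proof (rule disjCI)
    assume notin: "- A \<notin> U"
    \<comment> \<open>The filter generated by \<open>U\<close> and \<open>A\<close>; it is proper
      because \<open>- A\<close> is not in \<open>U\<close>.\<close>
    let ?X = "{X. \<exists>B\<in>U. B \<inter> A \<subseteq> X}"
    have "set_filter ?X"
    proof (rule set_filterI)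
      show "UNIV \<in> ?X" using set_filterD(1)[OF U(1)] by auto
      show "{} \<notin> ?X"
      proof
        assume "{} \<in> ?X"
        then obtain B where "B \<in> U" "B \<subseteq> - A" by auto
        then show False using notin set_filterD(4)[OF U(1)] by blast
      qed
      show "C \<inter> D \<in> ?X" if CD: "C \<in> ?X" "D \<in> ?X" for C D
      proof -
        obtain B B' where "B \<in> U" "B' \<in> U" "B \<inter> A \<subseteq> C" "B' \<inter> A \<subseteq> D"
          using CD by blast
        then show ?thesis
          using set_filterD(3)[OF U(1), of B B'] by blast
      qed
      show "D \<in> ?X" if "C \<in> ?X" "C \<subseteq> D" for C D
        using that by blast
    qed
    moreover have "U \<subseteq> ?X" by blast
    ultimately have "?X = U" by (rule max)
    then show "A \<in> U" using set_filterD(1)[OF U(1)] by blast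
  qed
  with U show thesis using that by blast
qed

text \<open>Zorn's lemma on subidempotent filters replaces the choice of a minimal closed
  subsemigroup. Starting from the cofinite filter \<open>?E\<close> rules out the principal
  ultrafilter at 0.\<close>

lemma ex_idempotent_ultrafilter:
  obtains U where "set_filter U" "\<And>A. A \<in> U \<or> - A \<in> U" "\<And>n. {n::nat..} \<in> U" "subidempotent U"
proof -
  let ?E = "{A. \<exists>n::nat. {n..} \<subseteq> A}"
  let ?S = "{F. set_filter F \<and> subidempotent F \<and> ?E \<subseteq> F}"
  have E: "set_filter ?E"
  proof (rule set_filterI)
    show "A \<inter> B \<in> ?E" if AB: "A \<in> ?E" "B \<in> ?E" for A B
    proof -
      obtain m n where "{m..} \<subseteq> A" "{n..} \<subseteq> B" using AB by blast
      then have "{max m n..} \<subseteq> A \<inter> B" by (meson Int_greatest atLeast_subset_iff max.cobounded1 max.cobounded2 subset_trans)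
      then show ?thesis by blast
    qed
  qed (auto)
  have "shift x A \<in> ?E" if A: "A \<in> ?E" for x A
  proof -
    obtain n where "{n..} \<subseteq> A" using A by blast
    then have "{n..} \<subseteq> shift x A" by (auto simp: shift_def subset_iff)
    then show ?thesis by blast
  qed
  then have E2: "subidempotent ?E"
    unfolding subidempotent_def by auto
  have "\<exists>U\<in>?S. \<forall>X\<in>?S. U \<subseteq> X \<longrightarrow> X = U"
  proof (rule subset_Zorn_nonempty)
    show "?S \<noteq> {}" using E E2 by blast
    fix \<C> assume \<C>: "\<C> \<noteq> {}" "subset.chain ?S \<C>"
    then have "subset.chain {F. set_filter F} \<C>"
      by (auto simp: subset.chain_def)
    then have filt: "set_filter (\<Union>\<C>)"
      using set_filter_Union_chain \<C>(1) by blast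
    have "{x. shift x A \<in> \<Union>\<C>} \<in> \<Union>\<C>" if A: "A \<in> \<Union>\<C>" for A
    proof -
      obtain F where F: "F \<in> \<C>" "A \<in> F" using A by blast
      then have "subidempotent F" using \<C> by (auto simp: subset.chain_def)
      then have "{x. shift x A \<in> F} \<in> \<Union>\<C>"
        using F unfolding subidempotent_def by blast
      then show ?thesis
        by (rule set_filterD(4)[OF filt]) (use F in auto)
    qed
    then have "subidempotent (\<Union>\<C>)" unfolding subidempotent_def by blast
    moreover have "?E \<subseteq> \<Union>\<C>"
      using \<C> unfolding subset.chain_def by blast
    ultimately show "\<Union>\<C> \<in> ?S" using filt by blast
  qed
  then obtain F where F: "set_filter F" "subidempotent F" "?E \<subseteq> F"
    and max: "\<And>X. set_filter X \<Longrightarrow> subidempotent X \<Longrightarrow> F \<subseteq> X \<Longrightarrow> X = F"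
    by (auto intro: subset_trans)
  note FD = set_filterD[OF F(1)]
  obtain U where U: "set_filter U" "F \<subseteq> U" "\<And>A. A \<in> U \<or> - A \<in> U"
    using ex_ultrafilter[OF F(1)] by blast
  note UD = set_filterD[OF U(1)]
  \<comment> \<open>\<open>R A\<close> lies in a filter exactly when \<open>A\<close> lies in the
    sum of that filter and \<open>U\<close>.\<close>
  define R where "R A = {x. shift x A \<in> U}" for A
  have R_Int: "R A \<inter> R B = R (A \<inter> B)" for A B
    using UD(3,4) unfolding R_def by (auto intro: UD(4)[of "shift _ A \<inter> shift _ B"])
  have R_mono: "R A \<subseteq> R B" if "A \<subseteq> B" for A B
    using UD(4) shift_mono[OF that] unfolding R_def by blast
  have R_shift: "shift x (R A) = R (shift x A)" for x A
    unfolding R_def by (simp add: shift_shift) (simp add: shift_def)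
  text \<open>
    Ellis' lemma in terms of filters: \<open>F\<close> stands for a minimal closed subsemigroup of
    the Stone-Cech compactification and \<open>U\<close> for one of its points; minimality gives \<open>F + U = F\<close>,
    then that the stabiliser of \<open>U\<close> is everything.
  \<close>
  let ?G = "{A. R A \<in> F}"
  have F_le_G: "F \<subseteq> ?G"
  proof
    fix A assume "A \<in> F"
    then have "{x. shift x A \<in> F} \<in> F" using F(2) unfolding subidempotent_def by blast
    then have "R A \<in> F" by (rule FD(4)) (use U(2) in \<open>auto simp: R_def\<close>)
    then show "A \<in> ?G" by simp
  qed
  have "set_filter ?G"
  proof (rule set_filterI)
    show "UNIV \<in> ?G" using UD(1) FD(1) by (simp add: R_def)
    show "{} \<notin> ?G" using UD(2) FD(2) by (simp add: R_def)
    show "A \<inter> B \<in> ?G" if "A \<in> ?G" "B \<in> ?G" for A B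
      using that FD(3) by (simp flip: R_Int)
    show "B \<in> ?G" if "A \<in> ?G" "A \<subseteq> B" for A B
      using that FD(4) R_mono by blast
  qed
  moreover have "subidempotent ?G"
    unfolding subidempotent_def
  proof
    fix A assume "A \<in> ?G"
    then have "{x. shift x (R A) \<in> F} \<in> F" using F(2) unfolding subidempotent_def by blast
    then show "{x. shift x A \<in> ?G} \<in> ?G" using F_le_G by (auto simp: R_shift)
  qed
  ultimately have G: "?G = F" using F_le_G by (rule max)
  \<comment> \<open>This filter describes the points \<open>p\<close> of the subsemigroup with
    \<open>p + U = U\<close>: they contain \<open>R A\<close> for every \<open>A\<close> in
    \<open>U\<close>.\<close>
  let ?H = "{X. \<exists>B\<in>F. \<exists>A\<in>U. B \<inter> R A \<subseteq> X}"
  have "set_filter ?H"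
  proof (rule set_filterI)
    show "UNIV \<in> ?H" using FD(1) UD(1) by blast
    show "{} \<notin> ?H"
    proof
      assume "{} \<in> ?H"
      then obtain A B where AB: "B \<in> F" "A \<in> U" "B \<inter> R A = {}" by blast
      \<comment> \<open>Properness rests on \<open>?G = F\<close>: the inclusion puts
        \<open>- A\<close> into \<open>?G\<close>, hence into \<open>F\<close> and into
        \<open>U\<close>, which already contains \<open>A\<close>.\<close>
      have "B \<subseteq> R (- A)"
      proof
        fix x assume "x \<in> B"
        then have "shift x A \<notin> U" using AB by (auto simp: R_def)
        then have "- shift x A \<in> U" using U(3) by blast
        moreover have "- shift x A = shift x (- A)" by (auto simp: shift_def)
        ultimately show "x \<in> R (- A)" by (simp add: R_def)
      qed
      then have "- A \<in> ?G" using AB(1) FD(4) by blast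
      then have "- A \<in> U" using G U(2) by blast
      then show False using UD(3)[OF AB(2)] UD(2) by fastforce
    qed
    show "X \<inter> Y \<in> ?H" if XY: "X \<in> ?H" "Y \<in> ?H" for X Y
    proof -
      obtain A B A' B' where *: "B \<in> F" "A \<in> U" "B \<inter> R A \<subseteq> X" "B' \<in> F" "A' \<in> U" "B' \<inter> R A' \<subseteq> Y"
        using XY by blast
      then have "(B \<inter> B') \<inter> R (A \<inter> A') \<subseteq> X \<inter> Y" by (auto simp flip: R_Int)
      moreover have "B \<inter> B' \<in> F" "A \<inter> A' \<in> U" using * FD(3) UD(3) by simp_all
      ultimately show ?thesis by blast
    qed
    show "Y \<in> ?H" if "X \<in> ?H" "X \<subseteq> Y" for X Y
      using that by blast
  qed
  moreover have "subidempotent ?H"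
    unfolding subidempotent_def
  proof
    fix X assume "X \<in> ?H"
    then obtain A B where AB: "B \<in> F" "A \<in> U" "B \<inter> R A \<subseteq> X" by blast
    have "shift x X \<in> ?H" if x: "shift x B \<in> F" "x \<in> R A" for x
    proof -
      have "shift x B \<inter> R (shift x A) \<subseteq> shift x X"
        using shift_mono[OF AB(3), of x] by (simp add: R_shift)
      moreover have "shift x A \<in> U" using x by (simp add: R_def)
      ultimately show ?thesis using x(1) by blast
    qed
    then have "{x. shift x B \<in> F} \<inter> R A \<subseteq> {x. shift x X \<in> ?H}" by blast
    moreover have "{x. shift x B \<in> F} \<in> F" using F(2) AB(1) unfolding subidempotent_def by blast
    ultimately show "{x. shift x X \<in> ?H} \<in> ?H" using AB(2) by blast
  qed
  moreover have "F \<subseteq> ?H" using UD(1) by blast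
  ultimately have H: "?H = F" by (rule max)
  \<comment> \<open>As \<open>U\<close> extends \<open>F = ?H\<close>, it stabilises itself.\<close>
  have "R A \<in> U" if "A \<in> U" for A
  proof -
    have "R A \<in> ?H" using that FD(1) by blast
    then show ?thesis using H U(2) by blast
  qed
  then have "subidempotent U" unfolding subidempotent_def R_def by blast
  then show thesis using that[of U] U F(3) by blast
qed

section \<open>The IP van der Waerden theorem\<close>

text \<open>The common difference is a finite sum of \<open>b\<close>. The bounds \<open>N\<close>
  and \<open>V\<close> leave finitely many differences and starting points, so that a pigeonhole
  argument can later select one difference.\<close>

definition mono_progression :: "nat \<Rightarrow> (nat \<Rightarrow> nat) \<Rightarrow> nat \<Rightarrow> nat \<Rightarrow> (nat \<Rightarrow> nat) \<Rightarrow> bool" where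
  "mono_progression k b N V \<chi> \<longleftrightarrow>
     (\<exists>v\<le>V. \<exists>I. I \<subseteq> {..<N} \<and> I \<noteq> {} \<and> (\<forall>j\<le>k. \<chi> (v + j * sum b I) = \<chi> v))"

definition arm :: "nat \<Rightarrow> (nat \<Rightarrow> nat) \<Rightarrow> nat \<Rightarrow> (nat \<Rightarrow> nat) \<Rightarrow> nat \<Rightarrow> nat \<Rightarrow> bool" where
  "arm k b N \<chi> f c \<longleftrightarrow> (\<exists>a I. I \<subseteq> {..<N} \<and> I \<noteq> {} \<and> a + Suc k * sum b I = f \<and>
     (\<forall>j\<le>k. \<chi> (a + j * sum b I) = c))"

lemma mono_progressionI:
  assumes "v \<le> V" "I \<subseteq> {..<N}" "I \<noteq> {}" "\<And>j. j \<le> k \<Longrightarrow> \<chi> (v + j * sum b I) = \<chi> v"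
  shows "mono_progression k b N V \<chi>"
  using assms unfolding mono_progression_def by (intro exI[of _ v] conjI exI[of _ I]) auto

lemma armI:
  assumes "I \<subseteq> {..<N}" "I \<noteq> {}" "a + Suc k * sum b I = f" "\<And>j. j \<le> k \<Longrightarrow> \<chi> (a + j * sum b I) = c"
  shows "arm k b N \<chi> f c"
  using assms unfolding arm_def by (intro exI[of _ a] exI[of _ I] conjI) auto

definition IP_vdW :: "nat \<Rightarrow> bool" where
  "IP_vdW k \<longleftrightarrow> (\<forall>(Q::nat set) (b::nat \<Rightarrow> nat). finite Q \<longrightarrow>
     (\<exists>N V. \<forall>\<chi>. range \<chi> \<subseteq> Q \<longrightarrow> mono_progression k b N V \<chi>))"

text \<open>
  Colour focusing: the \<open>s\<close> differently coloured progressions of length \<open>k + 1\<close> all have \<open>f\<close>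
  as their next term.
\<close>

lemma colour_focusing:
  fixes Q :: "nat set" and b :: "nat \<Rightarrow> nat"
  assumes IH: "IP_vdW k" and Q: "finite Q"
  shows "\<exists>N V. \<forall>\<chi>. range \<chi> \<subseteq> Q \<longrightarrow> mono_progression (Suc k) b N V \<chi> \<or>
    (\<exists>f\<le>V. \<exists>D. finite D \<and> card D = s \<and> (\<forall>c\<in>D. arm k b N \<chi> f c))"
proof (induction s)
  case 0
  show ?case by (rule exI[of _ 0], rule exI[of _ 0]) (auto intro: exI[of _ "{}"])
next
  case (Suc s)
  then obtain N V where NV: "\<And>\<chi>. range \<chi> \<subseteq> Q \<Longrightarrow> mono_progression (Suc k) b N V \<chi> \<or>
    (\<exists>f\<le>V. \<exists>D. finite D \<and> card D = s \<and> (\<forall>c\<in>D. arm k b N \<chi> f c))"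
    by blast
  \<comment> \<open>A new colour records the old colours of a window of \<open>V + 1\<close>
    points.\<close>
  let ?Q' = "list_encode ` {xs. set xs \<subseteq> Q \<and> length xs = Suc V}"
  have "finite ?Q'" using finite_lists_length_eq[OF Q] by simp
  then obtain N' V' where NV': "\<And>\<chi>. range \<chi> \<subseteq> ?Q' \<Longrightarrow> mono_progression k (\<lambda>i. b (N + i)) N' V' \<chi>"
    using IH unfolding IP_vdW_def by blast
  \<comment> \<open>Room for the start \<open>v\<close>, the old focus and the last step to the new
    focus.\<close>
  define B where "B = V' + V + Suc k * sum b {..<N + N'}"
  show ?case
  proof (rule exI[of _ "N + N'"], rule exI[of _ B], intro allI impI)
    fix \<chi> :: "nat \<Rightarrow> nat" assume \<chi>: "range \<chi> \<subseteq> Q"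
    define \<chi>' where "\<chi>' y = list_encode (map (\<lambda>t. \<chi> (y + t)) [0..<Suc V])" for y
    have "map (\<lambda>t. \<chi> (y + t)) [0..<Suc V] \<in> {xs. set xs \<subseteq> Q \<and> length xs = Suc V}" for y
      using \<chi> by auto
    then have "range \<chi>' \<subseteq> ?Q'" unfolding \<chi>'_def by blast
    from NV'[OF this] obtain v I' where v: "v \<le> V'" "I' \<subseteq> {..<N'}" "I' \<noteq> {}"
      and eq: "\<And>j. j \<le> k \<Longrightarrow> \<chi>' (v + j * sum (\<lambda>i. b (N + i)) I') = \<chi>' v"
      unfolding mono_progression_def by blast
    \<comment> \<open>The tail of \<open>b\<close> from \<open>N\<close> on was used, so
      \<open>J\<close> is disjoint from the index sets of the existing arms.\<close>
    define J where "J = (+) N ` I'"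
    have J: "J \<subseteq> {N..<N + N'}" "J \<noteq> {}" using v by (auto simp: J_def)
    have "finite J" using J(1) finite_subset by blast
    have sum_J: "sum (\<lambda>i. b (N + i)) I' = sum b J"
      by (simp add: J_def sum.reindex)
    have \<chi>_eq: "\<chi> (v + j * sum b J + t) = \<chi> (v + t)" if "j \<le> k" "t \<le> V" for j t
    proof -
      have "t \<in> set [0..<Suc V]" using that(2) by (simp add: less_Suc_eq_le del: upt_Suc)
      then show ?thesis
        using eq[OF that(1)] unfolding \<chi>'_def sum_J list_encode_eq map_eq_conv by blast
    qed
    \<comment> \<open>The arms are sought inside the window at \<open>v\<close>, whose colours
      repeat at its translates by \<open>j * sum b J\<close> for \<open>j \<le> k\<close>.\<close>
    let ?\<psi> = "\<lambda>t. \<chi> (v + t)"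
    have "range ?\<psi> \<subseteq> Q" using \<chi> by auto
    from NV[OF this] show "mono_progression (Suc k) b (N + N') B \<chi> \<or>
      (\<exists>f\<le>B. \<exists>D. finite D \<and> card D = Suc s \<and> (\<forall>c\<in>D. arm k b (N + N') \<chi> f c))"
    proof (elim disjE exE conjE)
      assume "mono_progression (Suc k) b N V ?\<psi>"
      then obtain w I where w: "w \<le> V" "I \<subseteq> {..<N}" "I \<noteq> {}"
        "\<forall>j\<le>Suc k. \<chi> (v + (w + j * sum b I)) = \<chi> (v + w)"
        unfolding mono_progression_def by blast
      have "v + w \<le> B" using w v by (simp add: B_def)
      moreover have "I \<subseteq> {..<N + N'}" using w(2) by auto
      moreover note w(3)
      moreover have "\<chi> (v + w + j * sum b I) = \<chi> (v + w)" if "j \<le> Suc k" for j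
        using w(4) that by (simp only: add.assoc)
      ultimately have "mono_progression (Suc k) b (N + N') B \<chi>"
        by (rule mono_progressionI[of "v + w" B I "N + N'" "Suc k" \<chi> b])
      then show ?thesis ..
    next
      fix f D assume f: "f \<le> V" and D: "finite D" "card D = s"
        and arms: "\<forall>c\<in>D. arm k b N ?\<psi> f c"
      show ?thesis
      \<comment> \<open>If the focus has the colour of an arm, it extends that arm by one term.
        Otherwise its colour is new and yields a further arm.\<close>
      proof (cases "\<chi> (v + f) \<in> D")
        case True
        from bspec[OF arms True] obtain a I where a: "I \<subseteq> {..<N}" "I \<noteq> {}" "a + Suc k * sum b I = f"
          "\<And>j. j \<le> k \<Longrightarrow> \<chi> (v + (a + j * sum b I)) = \<chi> (v + f)" unfolding arm_def by blast
        have all: "\<chi> (v + a + j * sum b I) = \<chi> (v + f)" if "j \<le> Suc k" for j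
        proof (cases "j = Suc k")
          case True
          then show ?thesis using a(3) by (simp add: add.assoc)
        next
          case False
          then show ?thesis using a(4)[of j] that by (simp add: add.assoc)
        qed
        have "v + a \<le> B" using a(3) v(1) f by (simp add: B_def)
        moreover have "I \<subseteq> {..<N + N'}" using a(1) by auto
        moreover note a(2)
        moreover have "\<chi> (v + a + j * sum b I) = \<chi> (v + a)" if "j \<le> Suc k" for j
          using all[OF that] all[of 0] by simp
        ultimately have "mono_progression (Suc k) b (N + N') B \<chi>"
          by (rule mono_progressionI[of "v + a" B I "N + N'" "Suc k" \<chi> b])
        then show ?thesis ..
      next
        case False
        \<comment> \<open>The new focus: every old arm gains \<open>sum b J\<close> in its
          difference, and the translates of the old focus form the additional arm.\<close>
        let ?f = "v + f + Suc k * sum b J"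
        have "sum b J \<le> sum b {..<N + N'}" using J by (intro sum_mono2) auto
        then have "Suc k * sum b J \<le> Suc k * sum b {..<N + N'}" by (rule mult_le_mono2)
        then have "?f \<le> B" using v(1) f unfolding B_def by linarith
        moreover have "finite (insert (\<chi> (v + f)) D)" "card (insert (\<chi> (v + f)) D) = Suc s"
          using D False by simp_all
        moreover have "arm k b (N + N') \<chi> ?f c" if c: "c \<in> insert (\<chi> (v + f)) D" for c
        proof (cases "c = \<chi> (v + f)")
          case True
          have "J \<subseteq> {..<N + N'}" using J(1) by auto
          moreover note J(2) refl
          moreover have "\<chi> (v + f + j * sum b J) = c" if "j \<le> k" for j
            using \<chi>_eq[OF that f] True by (simp add: ac_simps)
          ultimately show ?thesis by (rule armI[of J "N + N'" "v + f" k b ?f \<chi> c])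
        next
          case False
          with c have "c \<in> D" by simp
          from bspec[OF arms this] obtain a I where a: "I \<subseteq> {..<N}" "I \<noteq> {}" "a + Suc k * sum b I = f"
            "\<And>j. j \<le> k \<Longrightarrow> \<chi> (v + (a + j * sum b I)) = c" unfolding arm_def by blast
          have "finite I" using a(1) finite_subset by blast
          moreover have "I \<inter> J = {}" using a(1) J(1) by fastforce
          ultimately have sum_IJ: "sum b (I \<union> J) = sum b I + sum b J"
            using \<open>finite J\<close> by (intro sum.union_disjoint)
          have "I \<union> J \<subseteq> {..<N + N'}" "I \<union> J \<noteq> {}" using a(1,2) J(1) by auto
          moreover have "v + a + Suc k * sum b (I \<union> J) = ?f"
            by (simp add: sum_IJ algebra_simps flip: a(3))
          moreover have "\<chi> (v + a + j * sum b (I \<union> J)) = c" if j: "j \<le> k" for j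
          proof -
            \<comment> \<open>Terms of an arm do not exceed its focus, so they lie in the window
              where translation preserves colours.\<close>
            have "j * sum b I \<le> Suc k * sum b I" using j by (intro mult_le_mono1) simp
            then have "a + j * sum b I \<le> V" using a(3) f by linarith
            then have "\<chi> (v + j * sum b J + (a + j * sum b I)) = c"
              using \<chi>_eq[OF j, of "a + j * sum b I"] a(4)[OF j] by simp
            moreover have "v + a + j * sum b (I \<union> J) = v + j * sum b J + (a + j * sum b I)"
              by (simp add: sum_IJ algebra_simps)
            ultimately show ?thesis by (simp only:)
          qed
          ultimately show ?thesis by (rule armI[of "I \<union> J" "N + N'" "v + a" k b ?f \<chi> c])
        qed
        ultimately show ?thesis by blast
      qed
    qed
  qed
qed

text \<open>Focusing with one arm more than there are colours leaves only the longer
  progression.\<close>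

lemma IP_vdW: "IP_vdW k"
proof (induction k)
  case 0
  have "mono_progression 0 b 1 0 \<chi>" for \<chi> b
    unfolding mono_progression_def by (intro exI[of _ 0] conjI exI[of _ "{0}"]) auto
  then show ?case unfolding IP_vdW_def by blast
next
  case (Suc k)
  have "\<exists>N V. \<forall>\<chi>. range \<chi> \<subseteq> Q \<longrightarrow> mono_progression (Suc k) b N V \<chi>"
    if Q: "finite Q" for Q b
  proof -
    obtain N V where NV: "\<And>\<chi>. range \<chi> \<subseteq> Q \<Longrightarrow> mono_progression (Suc k) b N V \<chi> \<or>
      (\<exists>f\<le>V. \<exists>D. finite D \<and> card D = Suc (card Q) \<and> (\<forall>c\<in>D. arm k b N \<chi> f c))"
      using colour_focusing[OF Suc Q, of b "Suc (card Q)"] by blast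
    have "mono_progression (Suc k) b N V \<chi>" if \<chi>: "range \<chi> \<subseteq> Q" for \<chi>
    proof (rule ccontr)
      assume "\<not> mono_progression (Suc k) b N V \<chi>"
      then obtain f D where D: "card D = Suc (card Q)" "\<forall>c\<in>D. arm k b N \<chi> f c"
        using NV[OF \<chi>] by blast
      have "D \<subseteq> range \<chi>" using D(2) unfolding arm_def by (metis le0 rangeI subsetI)
      then have "card D \<le> card Q" using \<chi> by (intro card_mono[OF Q]) blast
      then show False using D(1) by simp
    qed
    then show ?thesis by blast
  qed
  then show ?case unfolding IP_vdW_def by blast
qed

section \<open>Large sets\<close>

locale idempotent_ultrafilter =
  fixes U :: "nat set set"
  assumes filter: "set_filter U"
    and ultra: "\<And>A. A \<in> U \<or> - A \<in> U"
    and free: "\<And>n. {n..} \<in> U"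
    and idem: "subidempotent U"
begin

lemmas UD = set_filterD[OF filter]

text \<open>Galvin's proof of Hindman's theorem: idempotence supplies \<open>x\<close> in a member
  \<open>B\<close> with \<open>shift x B\<close> again a member, and all later choices are made
  inside both sets.\<close>

lemma finite_sums_member:
  assumes "A \<in> U"
  shows "\<exists>b :: nat \<Rightarrow> nat. strict_mono b \<and> (\<forall>i. K < b i) \<and> (\<forall>H. finite H \<longrightarrow> H \<noteq> {} \<longrightarrow> sum b H \<in> A)"
proof -
  define good where "good S \<longleftrightarrow> fst S \<in> U \<and> shift (snd S) (fst S) \<in> U \<and> snd S \<in> fst S" for S
  define nxt where "nxt S S' \<longleftrightarrow> fst S' \<subseteq> fst S \<and> fst S' \<subseteq> shift (snd S) (fst S) \<and> fst S' \<subseteq> {snd S<..}"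
    for S S' :: "nat set \<times> nat"
  have ex: "\<exists>x. good (B, x)" if "B \<in> U" for B
  proof -
    have "{x. shift x B \<in> U} \<inter> B \<in> U" using idem that UD(3) unfolding subidempotent_def by blast
    then have "{x. shift x B \<in> U} \<inter> B \<noteq> {}" using UD(2) by metis
    then show ?thesis using that unfolding good_def by auto
  qed
  have gt: "{n<..} \<in> U" for n using free[of "Suc n"] by (simp add: atLeast_Suc_greaterThan)
  have "\<exists>f. \<forall>n. (good (f n) \<and> (n = 0 \<longrightarrow> fst (f n) = A \<inter> {K<..})) \<and> nxt (f n) (f (Suc n))"
  proof (rule dependent_nat_choice)
    have "A \<inter> {K<..} \<in> U" using assms gt UD(3) by blast
    from ex[OF this] show "\<exists>S. good S \<and> (0 = (0::nat) \<longrightarrow> fst S = A \<inter> {K<..})" by auto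
  next
    fix S and n :: nat assume "good S \<and> (n = 0 \<longrightarrow> fst S = A \<inter> {K<..})"
    then have "fst S \<inter> shift (snd S) (fst S) \<inter> {snd S<..} \<in> U"
      using gt UD(3) unfolding good_def by blast
    from ex[OF this] obtain x where "good (fst S \<inter> shift (snd S) (fst S) \<inter> {snd S<..}, x)" by blast
    then show "\<exists>S'. (good S' \<and> (Suc n = 0 \<longrightarrow> fst S' = A \<inter> {K<..})) \<and> nxt S S'"
      by (intro exI[of _ "(fst S \<inter> shift (snd S) (fst S) \<inter> {snd S<..}, x)"]) (auto simp: nxt_def)
  qed
  then obtain f where f: "\<And>n. good (f n)" "fst (f 0) = A \<inter> {K<..}" "\<And>n. nxt (f n) (f (Suc n))"
    by blast
  define b where "b n = snd (f n)" for n
  have in_f: "b n \<in> fst (f n)" for n using f(1)[of n] by (simp add: good_def b_def)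
  have anti: "fst (f n) \<subseteq> fst (f m)" if "m \<le> n" for m n
    by (rule lift_Suc_antimono_le[of "\<lambda>n. fst (f n)", OF _ that]) (use f(3) in \<open>simp add: nxt_def\<close>)
  \<comment> \<open>Induction removing the least index \<open>m\<close>: the remaining sum lies in
    \<open>fst (f (Suc m))\<close>, which is contained in
    \<open>shift (b m) (fst (f m))\<close>.\<close>
  have sums: "sum b H \<in> fst (f n)" if "finite H" "H \<noteq> {}" "H \<subseteq> {n..}" for H n
    using that
  proof (induction "card H" arbitrary: H n rule: less_induct)
    case less
    define m where "m = Min H"
    have m: "m \<in> H" "n \<le> m" using less.prems by (auto simp: m_def)
    have "sum b H \<in> fst (f m)"
    proof (cases "H - {m} = {}")
      case True
      then have "H = {m}" using m by blast
      then show ?thesis using in_f by simp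
    next
      case False
      have "H - {m} \<subseteq> {Suc m..}"
        using less.prems(1) by (auto simp: m_def Suc_le_eq order_less_le)
      moreover have "card (H - {m}) < card H" using m less.prems(1) by (intro psubset_card_mono) auto
      ultimately have "sum b (H - {m}) \<in> fst (f (Suc m))"
        using less.hyps False less.prems(1) by blast
      then have "sum b (H - {m}) \<in> shift (b m) (fst (f m))"
        using f(3)[of m] by (auto simp: nxt_def b_def)
      then show ?thesis using sum.remove[OF less.prems(1) m(1), of b] by (simp add: shift_def)
    qed
    then show ?case using anti[OF m(2)] by blast
  qed
  show ?thesis
  proof (intro exI[of _ b] conjI allI impI)
    have "b n < b (Suc n)" for n using f(3)[of n] in_f[of "Suc n"] by (auto simp: nxt_def b_def)
    then show "strict_mono b" by (simp add: strict_mono_Suc_iff)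
    show "K < b i" for i using in_f[of i] anti[of 0 i] f(2) by auto
    show "sum b H \<in> A" if "finite H" "H \<noteq> {}" for H using sums[OF that, of 0] f(2) by auto
  qed
qed

section \<open>Dilates of members of the ultrafilter\<close>

text \<open>The free factor \<open>n\<close> makes the property pass to dilates, while finite sums
  survive multiplication by \<open>n\<close>.\<close>

definition ip :: "nat set \<Rightarrow> bool" where
  "ip A \<longleftrightarrow> (\<exists>n>0. {x. n * x \<in> A} \<in> U)"

lemma ip_dilate:
  assumes "ip X" "0 < c" "\<And>x. x \<in> X \<Longrightarrow> c * x \<in> Y"
  shows "ip Y"
proof -
  obtain n where n: "0 < n" "{x. n * x \<in> X} \<in> U" using assms(1) by (auto simp: ip_def)
  have "{x. c * n * x \<in> Y} \<in> U"
    using n(2) by (rule UD(4)) (auto simp: mult.assoc assms(3))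
  then show ?thesis using n(1) assms(2) unfolding ip_def by (intro exI[of _ "c * n"]) auto
qed

lemma ip_mono: "ip X \<Longrightarrow> X \<subseteq> Y \<Longrightarrow> ip Y"
  using ip_dilate[of X 1 Y] by auto

text \<open>The factor \<open>n\<close> is kept, and the ultrafilter decides between the two
  preimages.\<close>

lemma ip_Un:
  assumes "ip (X \<union> Y)"
  shows "ip X \<or> ip Y"
proof -
  obtain n where n: "0 < n" "{x. n * x \<in> X \<union> Y} \<in> U" using assms by (auto simp: ip_def)
  show ?thesis
  proof (cases "{x. n * x \<in> X} \<in> U")
    case False
    then have "- {x. n * x \<in> X} \<in> U" using ultra by blast
    then have "- {x. n * x \<in> X} \<inter> {x. n * x \<in> X \<union> Y} \<in> U" using n(2) UD(3) by blast
    then have "{x. n * x \<in> Y} \<in> U" by (rule UD(4)) auto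
    then show ?thesis using n(1) by (auto simp: ip_def)
  qed (use n in \<open>auto simp: ip_def\<close>)
qed

lemma not_ip_empty: "\<not> ip {}"
  using UD(2) by (auto simp: ip_def)

lemma ip_UN:
  assumes "finite I" "ip (\<Union>i\<in>I. X i)"
  shows "\<exists>i\<in>I. ip (X i)"
  using assms by (induction I rule: finite_induct) (use ip_Un not_ip_empty in auto)

lemma finite_sums_ip:
  assumes "ip A"
  shows "\<exists>b :: nat \<Rightarrow> nat. strict_mono b \<and> (\<forall>i. K < b i) \<and> (\<forall>H. finite H \<longrightarrow> H \<noteq> {} \<longrightarrow> sum b H \<in> A)"
proof -
  obtain n where n: "0 < n" "{x. n * x \<in> A} \<in> U" using assms by (auto simp: ip_def)
  obtain b :: "nat \<Rightarrow> nat" where b: "strict_mono b" "\<And>i. K < b i"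
    "\<And>H. finite H \<Longrightarrow> H \<noteq> {} \<Longrightarrow> sum b H \<in> {x. n * x \<in> A}"
    using finite_sums_member[OF n(2), of K] by blast
  show ?thesis
  proof (intro exI[of _ "\<lambda>i. n * b i"] conjI allI impI)
    show "strict_mono (\<lambda>i. n * b i)" using b(1) n(1) by (simp add: strict_mono_def)
    show "K < n * b i" for i
      using b(2)[of i] n(1) by (metis One_nat_def Suc_leI less_le_trans mult_le_mono1 nat_mult_1)
    show "sum (\<lambda>i. n * b i) H \<in> A" if "finite H" "H \<noteq> {}" for H
      using b(3)[OF that] by (simp add: sum_distrib_left)
  qed
qed

text \<open>The multipliers \<open>F\<close> form the syndetic part and the sets \<open>G\<close>
  the thick part, with \<open>F\<close> chosen first. Ordinary multiplicative piecewise syndeticity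
  asks only for one positive \<open>x\<close> for each \<open>G\<close>.\<close>

definition large :: "nat set \<Rightarrow> bool" where
  "large B \<longleftrightarrow> (\<exists>F. finite F \<and> 0 \<notin> F \<and>
     (\<forall>G. finite G \<longrightarrow> 0 \<notin> G \<longrightarrow> ip {x. \<forall>g\<in>G. \<exists>n\<in>F. n * (g * x) \<in> B}))"

lemma large_UNIV: "large UNIV"
  unfolding large_def ip_def using UD(1) by (intro exI[of _ "{1}"]) auto

text \<open>With \<open>G = {1}\<close>, finitely many preimages of \<open>B\<close> cover an
  \<open>ip\<close> set; one of them is \<open>ip\<close>, and so is its dilate inside
  \<open>B\<close>.\<close>

lemma large_imp_ip:
  assumes "large B"
  shows "ip B"
proof -
  obtain F where F: "finite F" "0 \<notin> F"
    "\<And>G. finite G \<Longrightarrow> 0 \<notin> G \<Longrightarrow> ip {x. \<forall>g\<in>G. \<exists>n\<in>F. n * (g * x) \<in> B}"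
    using assms unfolding large_def by blast
  have "ip (\<Union>n\<in>F. {x. n * x \<in> B})" using F(3)[of "{1}"] by (rule ip_mono) auto
  then obtain n where "n \<in> F" "ip {x. n * x \<in> B}" using ip_UN[OF F(1)] by blast
  then show ?thesis using F(2) ip_dilate[of "{x. n * x \<in> B}" n B] by (cases n) auto
qed

text \<open>If \<open>B\<close> is not large, some \<open>G1\<close> defeats the multipliers
  \<open>F\<close>. A point of \<open>?X\<close> where \<open>B'\<close> fails for all products from
  \<open>F\<close> and \<open>G1\<close> is carried by some \<open>g\<close> into \<open>Z\<close>,
  which is not \<open>ip\<close>; so the other points form an \<open>ip\<close> set.\<close>

lemma large_Un:
  assumes "large (B \<union> B')"
  shows "large B \<or> large B'"
  unfolding disj_imp
proof
  assume "\<not> large B"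
  obtain F where F: "finite F" "0 \<notin> F"
    "\<And>G. finite G \<Longrightarrow> 0 \<notin> G \<Longrightarrow> ip {x. \<forall>g\<in>G. \<exists>n\<in>F. n * (g * x) \<in> B \<union> B'}"
    using assms unfolding large_def by blast
  then obtain G1 where G1: "finite G1" "0 \<notin> G1" and
    notip: "\<not> ip {x. \<forall>g\<in>G1. \<exists>n\<in>F. n * (g * x) \<in> B}"
    using \<open>\<not> large B\<close> unfolding large_def by blast
  define Z where "Z = {x. \<forall>g\<in>G1. \<exists>n\<in>F. n * (g * x) \<in> B}"
  define F' where "F' = (\<lambda>(n, g). n * g) ` (F \<times> G1)"
  have F': "finite F'" "0 \<notin> F'" using F(1,2) G1 by (auto simp: F'_def)
  have "ip {x. \<forall>g\<in>G. \<exists>n\<in>F'. n * (g * x) \<in> B'}" (is "ip ?Y") if G: "finite G" "0 \<notin> G" for G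
  proof -
    define G' where "G' = (\<lambda>(h, g). h * g) ` (G1 \<times> G)"
    have "finite G'" "0 \<notin> G'" using G G1 by (auto simp: G'_def)
    then have "ip {x. \<forall>g\<in>G'. \<exists>n\<in>F. n * (g * x) \<in> B \<union> B'}" (is "ip ?X") by (rule F(3))
    moreover have "?X \<subseteq> ?Y \<union> (\<Union>g\<in>G. {x. g * x \<in> Z})"
    proof
      fix x assume x: "x \<in> ?X"
      show "x \<in> ?Y \<union> (\<Union>g\<in>G. {x. g * x \<in> Z})"
      proof (cases "x \<in> ?Y")
        case False
        then obtain g where g: "g \<in> G" "\<And>n. n \<in> F' \<Longrightarrow> n * (g * x) \<notin> B'" by blast
        have "\<exists>n\<in>F. n * (h * (g * x)) \<in> B" if h: "h \<in> G1" for h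
        proof -
          have "h * g \<in> G'" using h g(1) by (auto simp: G'_def)
          then obtain n where n: "n \<in> F" "n * (h * g * x) \<in> B \<union> B'" using x by blast
          moreover have "n * h \<in> F'" using n(1) h by (auto simp: F'_def)
          ultimately show ?thesis using g(2)[of "n * h"] by (auto simp: mult.assoc)
        qed
        then have "g * x \<in> Z" by (simp add: Z_def)
        then show ?thesis using g(1) by blast
      qed simp
    qed
    ultimately have "ip (?Y \<union> (\<Union>g\<in>G. {x. g * x \<in> Z}))" by (rule ip_mono)
    moreover have "\<not> ip (\<Union>g\<in>G. {x. g * x \<in> Z})"
    proof
      assume "ip (\<Union>g\<in>G. {x. g * x \<in> Z})"
      then obtain g where "g \<in> G" "ip {x. g * x \<in> Z}" using ip_UN[OF G(1)] by blast
      then have "ip Z" using G(2) ip_dilate[of "{x. g * x \<in> Z}" g Z] by (cases g) auto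
      then show False using notip by (simp add: Z_def)
    qed
    ultimately show ?thesis using ip_Un by blast
  qed
  then show "large B'" using F' unfolding large_def by blast
qed

lemma not_large_empty: "\<not> large {}"
  using large_imp_ip not_ip_empty by blast

lemma large_UN:
  assumes "finite I" "large (\<Union>i\<in>I. X i)"
  shows "\<exists>i\<in>I. large (X i)"
  using assms by (induction I rule: finite_induct) (use large_Un not_large_empty in auto)

section \<open>Recurrence and the construction of exponents\<close>

text \<open>Candidates for \<open>d\<close> are the finitely many sums of an initial piece of a
  sequence whose finite sums lie in \<open>B\<close>. Van der Waerden along exponents of 2 shows
  that the sets \<open>C d\<close> have a large union, and partition regularity selects one
  \<open>d\<close>.\<close>

lemma large_recurrence:
  assumes "large B"
  obtains d where "d \<in> B" "K < d" "large {y. \<forall>j\<le>k. 2 ^ (d * j) * y \<in> B}"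
proof -
  obtain F where F: "finite F" "0 \<notin> F"
    "\<And>G. finite G \<Longrightarrow> 0 \<notin> G \<Longrightarrow> ip {x. \<forall>g\<in>G. \<exists>n\<in>F. n * (g * x) \<in> B}"
    using assms unfolding large_def by blast
  obtain b :: "nat \<Rightarrow> nat" where b: "strict_mono b" "\<And>i. K < b i"
    "\<And>H. finite H \<Longrightarrow> H \<noteq> {} \<Longrightarrow> sum b H \<in> B"
    using finite_sums_ip[OF large_imp_ip[OF assms], of K] by blast
  obtain N V where NV: "\<And>\<chi>. range \<chi> \<subseteq> F \<Longrightarrow> mono_progression k b N V \<chi>"
    using IP_vdW[of k] F(1) unfolding IP_vdW_def by blast
  define D where "D = sum b ` {I. I \<subseteq> {..<N} \<and> I \<noteq> {}}"
  define C where "C d = {y. \<forall>j\<le>k. 2 ^ (d * j) * y \<in> B}" for d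
  have "finite D" by (auto simp: D_def)
  have D: "d \<in> B" "K < d" if d: "d \<in> D" for d
  proof -
    obtain I where I: "d = sum b I" "finite I" "I \<noteq> {}"
      using d finite_subset by (auto simp: D_def)
    then show "d \<in> B" using b(3) by simp
    obtain i where "i \<in> I" using I by blast
    then have "b i \<le> d" using I by (auto intro: member_le_sum)
    then show "K < d" using b(2)[of i] by simp
  qed
  define F' where "F' = (\<lambda>(n, v). n * 2 ^ v) ` (F \<times> {..V})"
  have F': "finite F'" "0 \<notin> F'" using F(1,2) by (auto simp: F'_def)
  have "ip {x. \<forall>g\<in>G. \<exists>n\<in>F'. n * (g * x) \<in> (\<Union>d\<in>D. C d)}" (is "ip ?Y")
    if G: "finite G" "0 \<notin> G" for G
  proof -
    \<comment> \<open>A bound for every exponent \<open>v + j * sum b I\<close> that a progression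
      can reach.\<close>
    define W where "W = V + k * sum b {..<N}"
    define G' where "G' = (\<lambda>(t, g). 2 ^ t * g) ` ({..W} \<times> G)"
    have "finite G'" "0 \<notin> G'" using G by (auto simp: G'_def)
    then have "ip {x. \<forall>g\<in>G'. \<exists>n\<in>F. n * (g * x) \<in> B}" (is "ip ?X") by (rule F(3))
    moreover have "?X \<subseteq> ?Y"
    proof clarify
      fix x g assume x: "\<forall>g\<in>G'. \<exists>n\<in>F. n * (g * x) \<in> B" and g: "g \<in> G"
      \<comment> \<open>The colour of \<open>t\<close> is a multiplier taking
        \<open>2 ^ t * g * x\<close> into \<open>B\<close>. Above \<open>W\<close> any element of
        \<open>F\<close> serves, which makes the colouring total.\<close>
      have "\<forall>t. \<exists>n\<in>F. t \<le> W \<longrightarrow> n * (2 ^ t * g * x) \<in> B"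
      proof
        fix t
        have "2 ^ s * g \<in> G'" if "s \<le> W" for s using that g by (auto simp: G'_def)
        then have *: "\<exists>n\<in>F. n * (2 ^ s * g * x) \<in> B" if "s \<le> W" for s using x that by blast
        show "\<exists>n\<in>F. t \<le> W \<longrightarrow> n * (2 ^ t * g * x) \<in> B" using *[of t] *[of 0] by blast
      qed
      then obtain \<chi> where \<chi>: "\<And>t. \<chi> t \<in> F" "\<And>t. t \<le> W \<Longrightarrow> \<chi> t * (2 ^ t * g * x) \<in> B"
        by metis
      have "range \<chi> \<subseteq> F" using \<chi>(1) by blast
      from NV[OF this] obtain v I where v: "v \<le> V" "I \<subseteq> {..<N}" "I \<noteq> {}"
        "\<And>j. j \<le> k \<Longrightarrow> \<chi> (v + j * sum b I) = \<chi> v" unfolding mono_progression_def by blast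
      have "2 ^ (sum b I * j) * (\<chi> v * 2 ^ v * (g * x)) \<in> B" if j: "j \<le> k" for j
      proof -
        have "sum b I \<le> sum b {..<N}" using v(2) by (intro sum_mono2) auto
        then have "j * sum b I \<le> k * sum b {..<N}" using j by (rule mult_le_mono[rotated])
        then have "v + j * sum b I \<le> W" using v(1) by (simp add: W_def)
        then have "\<chi> v * (2 ^ (v + j * sum b I) * g * x) \<in> B" using \<chi>(2) v(4)[OF j] by metis
        then show ?thesis by (simp add: power_add ac_simps)
      qed
      then have "\<chi> v * 2 ^ v * (g * x) \<in> C (sum b I)" by (simp add: C_def)
      moreover have "sum b I \<in> D" using v by (auto simp: D_def)
      moreover have "\<chi> v * 2 ^ v \<in> F'" using \<chi>(1) v(1) by (auto simp: F'_def)
      ultimately show "\<exists>n\<in>F'. n * (g * x) \<in> (\<Union>d\<in>D. C d)" by blast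
    qed
    ultimately show ?thesis by (rule ip_mono)
  qed
  then have "large (\<Union>d\<in>D. C d)" using F' unfolding large_def by blast
  then obtain d where "d \<in> D" "large (C d)" using large_UN \<open>finite D\<close> by blast
  then show thesis using that D unfolding C_def by blast
qed

text \<open>
  \<open>E n\<close> collects the exponents of the towers with indices below \<open>n\<close>.
\<close>

lemma large_exponents:
  assumes "large A"
  shows "\<exists>(a :: nat \<Rightarrow> nat) E. inj a \<and> (\<forall>n. E n \<subseteq> A) \<and>
    (\<forall>n. E n \<union> {a n} \<union> (\<lambda>e. a n * 2 ^ e) ` E n \<subseteq> E (Suc n))"
proof -
  \<comment> \<open>\<open>B\<close> is the reservoir for later choices: the last clause guarantees
    that any \<open>d\<close> drawn from it has \<open>d * 2 ^ e\<close> in \<open>A\<close> for all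
    collected \<open>e\<close>.\<close>
  define good where "good S \<longleftrightarrow> (case S of (B, E) \<Rightarrow> large B \<and> B \<subseteq> A \<and> finite E \<and> E \<subseteq> A \<and>
      (\<forall>e\<in>E. \<forall>y\<in>B. y * 2 ^ e \<in> A))" for S
  define nxt where "nxt S S' \<longleftrightarrow>
      (\<exists>d. (\<forall>e\<in>snd S. e < d) \<and> snd S \<union> {d} \<union> (\<lambda>e. d * 2 ^ e) ` snd S = snd S')"
    for S S' :: "nat set \<times> nat set"
  have "\<exists>f. \<forall>n. good (f n) \<and> nxt (f n) (f (Suc n))"
  proof (rule dependent_nat_choice)
    show "\<exists>S. good S" using assms by (intro exI[of _ "(A, {})"]) (auto simp: good_def)
  next
    fix S assume S: "good S"
    obtain B E where BE: "S = (B, E)" by fastforce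
    have B: "large B" "B \<subseteq> A" "finite E" "E \<subseteq> A" "\<And>e y. e \<in> E \<Longrightarrow> y \<in> B \<Longrightarrow> y * 2 ^ e \<in> A"
      using S by (auto simp: good_def BE)
    \<comment> \<open>The sum is a convenient upper bound of \<open>E\<close>. Then \<open>k\<close>
      admits \<open>j = 0\<close>, which keeps \<open>B'\<close> inside \<open>B\<close>,
      \<open>j = 1\<close> for the new exponent \<open>d\<close>, and \<open>j = 2 ^ e\<close> for
      the exponents \<open>d * 2 ^ e\<close>.\<close>
    define K where "K = \<Sum>E"
    define k :: nat where "k = 2 ^ K"
    have K: "e \<le> K" if "e \<in> E" for e using member_le_sum[of e E id] that B(3) by (simp add: K_def)
    obtain d where d: "d \<in> B" "K < d" "large {y. \<forall>j\<le>k. 2 ^ (d * j) * y \<in> B}"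
      by (rule large_recurrence[OF B(1), of K k])
    define B' where "B' = {y. \<forall>j\<le>k. 2 ^ (d * j) * y \<in> B}"
    define E' where "E' = E \<union> {d} \<union> (\<lambda>e. d * 2 ^ e) ` E"
    have B': "y * 2 ^ (d * j) \<in> B" if "y \<in> B'" "j \<le> k" for y j
      using that by (subst mult.commute[of y]) (simp add: B'_def)
    have "B' \<subseteq> B" using B'[of _ 0] by auto
    moreover have "y * 2 ^ e \<in> A" if e: "e \<in> E'" and y: "y \<in> B'" for e y
      using e unfolding E'_def
    proof (elim UnE)
      assume "e \<in> E" then show ?thesis using B(5) y \<open>B' \<subseteq> B\<close> by blast
    next
      assume "e \<in> {d}" then show ?thesis using B'[OF y, of 1] B(2) by (auto simp: k_def)
    next
      assume "e \<in> (\<lambda>e. d * 2 ^ e) ` E"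
      then obtain e' where e': "e' \<in> E" "e = d * 2 ^ e'" by blast
      then have "2 ^ e' \<le> k" using K by (simp add: k_def)
      then show ?thesis using B'[OF y] e'(2) B(2) by blast
    qed
    moreover have "E' \<subseteq> A" using B d(1) by (auto simp: E'_def)
    moreover have "large B'" using d(3) by (simp add: B'_def)
    moreover have "finite E'" using B(3) by (simp add: E'_def)
    ultimately have "good (B', E')" using B(2) by (auto simp: good_def)
    moreover have "nxt S (B', E')"
      unfolding nxt_def BE using K d(2) by (intro exI[of _ d]) (force simp: E'_def)
    ultimately show "\<exists>S'. good S' \<and> nxt S S'" by blast
  qed
  then obtain f where f: "\<And>n. good (f n)" "\<And>n. nxt (f n) (f (Suc n))" by blast
  define E where "E n = snd (f n)" for n
  have "\<forall>n. \<exists>d. (\<forall>e\<in>E n. e < d) \<and> E n \<union> {d} \<union> (\<lambda>e. d * 2 ^ e) ` E n = E (Suc n)"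
    using f(2) by (auto simp: nxt_def E_def)
  then obtain a where a: "\<And>n e. e \<in> E n \<Longrightarrow> e < a n"
    "\<And>n. E n \<union> {a n} \<union> (\<lambda>e. a n * 2 ^ e) ` E n = E (Suc n)" by metis
  show ?thesis
  proof (intro exI[of _ a] exI[of _ E] conjI allI)
    \<comment> \<open>\<open>a n\<close> has itself been collected in \<open>E (Suc n)\<close>, so
      the next choice exceeds it.\<close>
    have "a n < a (Suc n)" for n using a(1)[of "a n" "Suc n"] a(2)[of n] by blast
    then have "strict_mono a" by (simp add: strict_mono_Suc_iff)
    then show "inj a" by (rule strict_mono_imp_inj_on)
    show "E n \<subseteq> A" for n using f(1)[of n] by (auto simp: good_def E_def)
    show "E n \<union> {a n} \<union> (\<lambda>e. a n * 2 ^ e) ` E n \<subseteq> E (Suc n)" for n using a(2) by blast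
  qed
qed

end

section \<open>Transfer from exponents to towers and products\<close>

text \<open>The largest index is the base, so appending \<open>i\<close> turns \<open>2 ^ e\<close>
  into \<open>(2 ^ a i) ^ (2 ^ e) = 2 ^ (a i * 2 ^ e)\<close>; hence the induction from the
  right.\<close>

lemma tower_exponents:
  fixes a :: "nat \<Rightarrow> nat"
  assumes E: "\<And>n. E n \<union> {a n} \<union> (\<lambda>e. a n * 2 ^ e) ` E n \<subseteq> E (Suc n)"
    and "is \<noteq> []" "sorted_wrt (<) is" "\<And>i. i \<in> set is \<Longrightarrow> i < n"
  shows "\<exists>e\<in>E n. tower (map (\<lambda>i. 2 ^ a i) (rev is)) = 2 ^ e"
  using assms(2-)
proof (induction "is" arbitrary: n rule: rev_induct)
  case (snoc i js)
  have "E (Suc i) \<subseteq> E n"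
    by (rule lift_Suc_mono_le[of E]) (use E snoc.prems(3)[of i] in \<open>auto simp: Suc_le_eq\<close>)
  moreover have "\<exists>e\<in>E (Suc i). tower (map (\<lambda>i. 2 ^ a i) (rev (js @ [i]))) = 2 ^ e"
  proof (cases "js = []")
    case True
    then show ?thesis using E[of i] by (intro bexI[of _ "a i"]) auto
  next
    case False
    have "\<And>j. j \<in> set js \<Longrightarrow> j < i" "sorted_wrt (<) js"
      using snoc.prems(2) by (auto simp: sorted_wrt_append)
    then obtain e where e: "e \<in> E i" "tower (map (\<lambda>i. 2 ^ a i) (rev js)) = 2 ^ e"
      using snoc.IH False by blast
    then show ?thesis using E[of i] by (intro bexI[of _ "a i * 2 ^ e"]) (auto simp: power_mult)
  qed
  ultimately show ?case by blast
qed simp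

theorem theorem4p8:
  fixes P :: "nat set set"
  assumes "partition_on {1..} P"
    and "finite P"
  shows "\<exists>x y :: nat \<Rightarrow> nat.
           inj x \<and> range x \<subseteq> {1..} \<and> inj y \<and> range y \<subseteq> {1..} \<and>
           (\<exists>C\<in>P. FEX x \<union> FP y \<subseteq> C)"
proof -
  obtain U where "set_filter U" "\<And>A. A \<in> U \<or> - A \<in> U" "\<And>n. {n::nat..} \<in> U" "subidempotent U"
    using ex_idempotent_ultrafilter by blast
  then interpret idempotent_ultrafilter U by unfold_locales
  \<comment> \<open>Pulling the cells back along powers of 2 colours all exponents, 0
    included.\<close>
  have "(2::nat) ^ n \<in> \<Union>P" for n
    using partition_onD1[OF assms(1)] by (metis atLeast_iff one_le_numeral one_le_power)
  then have "(\<Union>C\<in>P. {n. 2 ^ n \<in> C}) = UNIV" by blast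
  then obtain C where "C \<in> P" "large {n. 2 ^ n \<in> C}"
    using large_UN[OF assms(2), of "\<lambda>C. {n. 2 ^ n \<in> C}"] large_UNIV by auto
  define A where "A = {n. 2 ^ n \<in> C}"
  have "large A" unfolding A_def by fact
  obtain b :: "nat \<Rightarrow> nat" where b: "strict_mono b" "\<And>H. finite H \<Longrightarrow> H \<noteq> {} \<Longrightarrow> sum b H \<in> A"
    using finite_sums_ip[OF large_imp_ip[OF \<open>large A\<close>], of 0] by blast
  obtain a E where a: "inj a" "\<And>n. E n \<subseteq> A"
    "\<And>n. E n \<union> {a n} \<union> (\<lambda>e. a n * 2 ^ e) ` E n \<subseteq> E (Suc n)"
    using large_exponents[OF \<open>large A\<close>] by blast
  let ?x = "\<lambda>i. 2 ^ a i :: nat" and ?y = "\<lambda>i. 2 ^ b i :: nat"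
  have inj: "inj ?x" "inj ?y"
    using a(1) strict_mono_eq[OF b(1)] by (simp_all add: inj_def)
  have range: "range ?x \<subseteq> {1..}" "range ?y \<subseteq> {1..}" by auto
  have FEX: "FEX ?x \<subseteq> C"
  proof
    fix z assume "z \<in> FEX ?x"
    then obtain "is" where z: "z = tower (map ?x (rev is))" "is \<noteq> []" "sorted_wrt (<) is"
      by (auto simp: FEX_def)
    have "\<exists>e\<in>E (Suc (Max (set is))). tower (map ?x (rev is)) = 2 ^ e"
      using z(2,3) by (rule tower_exponents[of E a, OF a(3)]) (simp add: less_Suc_eq_le)
    then obtain e where e: "e \<in> E (Suc (Max (set is)))" "tower (map ?x (rev is)) = 2 ^ e"
      by (rule bexE)
    have "e \<in> A" using e(1) a(2) by (rule subsetD[rotated])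
    then show "z \<in> C" unfolding z(1) e(2) by (simp add: A_def)
  qed
  have "(\<Prod>t\<in>H. ?y t) \<in> C" if "finite H" "H \<noteq> {}" for H
    using b(2)[OF that] by (simp add: power_sum A_def)
  then have FP: "FP ?y \<subseteq> C" unfolding FP_def by blast
  show ?thesis
    by (intro exI[of _ ?x] exI[of _ ?y] conjI inj range bexI[OF _ \<open>C \<in> P\<close>] Un_least FEX FP)
qed

end
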